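(* Let $P$ be the set of prime numbers and let $x$ be an indeterminate. Then, as an identity of formal Dirichlet series (in the formal variable $s$) with coefficients in $\mathbb{Z}[x]$, $$\prod_{p\in P}\left[1+\sum_{m=1}^{\infty}\frac{(1+m)\,x}{p^{ms}}\right]=1+\sum_{N=2}^{\infty}\frac{d(N)\,x^{\omega(N)}}{N^s},$$ where $d(N)$ is the number of positive divisors of $N$ (including $N$ itself), and $\omega(N)$ is the number of distinct prime divisors of $N$.
   Context: A formal Dirichlet series with coefficients in a commutative ring $R$ is a function $a:\{1,2,3,\dots\}\to R$, written $\sum_{n\ge1}a(n)/n^s$. Addition is termwise and multiplication is Dirichlet convolution, $(ab)(n)=\sum_{de=n}a(d)b(e)$. The series $1+\sum_{m\ge1}c_m/p^{ms}$ is the one with coefficient $1$ at $n=1$, coefficient $c_m$ at $n=p^m$, and $0$ elsewhere. An infinite product over primes is the coefficientwise limit of the finite products over $p\le y$ as $y\to\infty$, where for each $n$ the coefficient at $n$ is eventually constant in $y$. *)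

theory Defs
  imports "HOL-Computational_Algebra.Polynomial" "HOL-Computational_Algebra.Primes"
begin

text \<open>
  A formal Dirichlet series is a function on the positive integers. It is encoded as a function
  on all of \<^typ>\<open>nat\<close> whose value at the meaningless index 0 is normalised to 0, so that equality
  of series is equality of the coefficients at the positive indices.
\<close>

typedef (overloaded) 'a fds = "{f :: nat \<Rightarrow> 'a :: zero. f 0 = 0}"
  morphisms fds_nth Abs_fds
  by (rule exI[of _ "\<lambda>_. 0"]) simp

definition fds :: "(nat \<Rightarrow> 'a :: zero) \<Rightarrow> 'a fds" where
  "fds f = Abs_fds (\<lambda>n. if n = 0 then 0 else f n)"

lemma fds_nth_0 [simp]: "fds_nth a 0 = 0"
  using fds_nth[of a] by simp

lemma fds_nth_fds: "fds_nth (fds f) n = (if n = 0 then 0 else f n)"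
  unfolding fds_def by (subst Abs_fds_inverse) auto

lemma fds_eqI:
  assumes "\<And>n. n > 0 \<Longrightarrow> fds_nth a n = fds_nth b n"
  shows "a = b"
proof -
  have "fds_nth a n = fds_nth b n" for n
    using assms[of n] by (cases "n = 0") auto
  then show ?thesis by (simp add: fds_nth_inject[symmetric] fun_eq_iff)
qed

lemma finite_factor_pairs:
  assumes "n > (0::nat)"
  shows "finite {(d, e). d * e = n}"
proof (rule finite_subset)
  show "{(d, e). d * e = n} \<subseteq> {..n} \<times> {..n}"
    using assms by auto
qed auto

lemma sum_factor_pairs_assoc:
  fixes f g h :: "nat \<Rightarrow> 'a :: comm_ring_1"
  assumes n: "n > 0"
  shows "(\<Sum>(d, e) | d * e = n. (\<Sum>(a, b) | a * b = d. f a * g b) * h e) =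
         (\<Sum>(d, e) | d * e = n. f d * (\<Sum>(a, b) | a * b = e. g a * h b))"
proof -
  have pos: "d > 0 \<and> e > 0" if "d * e = n" for d e
    using that n by (cases "d = 0"; cases "e = 0") auto
  have "(\<Sum>(d, e) | d * e = n. (\<Sum>(a, b) | a * b = d. f a * g b) * h e) =
        (\<Sum>x\<in>{(d, e). d * e = n}. \<Sum>y\<in>{(a, b). a * b = fst x}. f (fst y) * g (snd y) * h (snd x))"
    by (simp add: sum_distrib_right case_prod_beta)
  also have "\<dots> = (\<Sum>(x, y)\<in>(SIGMA x:{(d, e). d * e = n}. {(a, b). a * b = fst x}).
                   f (fst y) * g (snd y) * h (snd x))"
    using pos n by (intro sum.Sigma ballI finite_factor_pairs) auto
  also have "\<dots> = (\<Sum>(x, y)\<in>(SIGMA x:{(d, e). d * e = n}. {(a, b). a * b = snd x}).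
                   f (fst x) * (g (fst y) * h (snd y)))"
    by (rule sum.reindex_bij_witness
          [where i = "\<lambda>((a, e), (b, c)). ((a * b, c), (a, b))"
             and j = "\<lambda>((d, c), (a, b)). ((a, b * c), (b, c))"])
       (auto simp: mult_ac)
  also have "\<dots> = (\<Sum>x\<in>{(d, e). d * e = n}. \<Sum>y\<in>{(a, b). a * b = snd x}. f (fst x) * (g (fst y) * h (snd y)))"
    using pos n by (intro sum.Sigma[symmetric] ballI finite_factor_pairs) auto
  also have "\<dots> = (\<Sum>(d, e) | d * e = n. f d * (\<Sum>(a, b) | a * b = e. g a * h b))"
    by (simp add: sum_distrib_left case_prod_beta)
  finally show ?thesis .
qed

instantiation fds :: (comm_ring_1) comm_ring_1
begin

definition zero_fds :: "'a fds" where "0 = fds (\<lambda>_. 0)"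

definition one_fds :: "'a fds" where "1 = fds (\<lambda>n. if n = 1 then 1 else 0)"

definition plus_fds :: "'a fds \<Rightarrow> 'a fds \<Rightarrow> 'a fds" where
  "a + b = fds (\<lambda>n. fds_nth a n + fds_nth b n)"

definition uminus_fds :: "'a fds \<Rightarrow> 'a fds" where
  "- a = fds (\<lambda>n. - fds_nth a n)"

definition minus_fds :: "'a fds \<Rightarrow> 'a fds \<Rightarrow> 'a fds" where
  "a - b = fds (\<lambda>n. fds_nth a n - fds_nth b n)"

definition times_fds :: "'a fds \<Rightarrow> 'a fds \<Rightarrow> 'a fds" where
  "a * b = fds (\<lambda>n. \<Sum>(d, e) | d * e = n. fds_nth a d * fds_nth b e)"

lemmas fds_ring_defs = zero_fds_def one_fds_def plus_fds_def uminus_fds_def minus_fds_def times_fds_def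

instance
proof
  fix a b c :: "'a fds"
  show "a * b * c = a * (b * c)"
  proof (rule fds_eqI)
    fix n :: nat assume n: "n > 0"
    have "fds_nth (a * b * c) n =
       (\<Sum>(d, e) | d * e = n. (\<Sum>(i, j) | i * j = d. fds_nth a i * fds_nth b j) * fds_nth c e)"
      using n by (auto simp: times_fds_def fds_nth_fds intro!: sum.cong)
    also have "\<dots> =
       (\<Sum>(d, e) | d * e = n. fds_nth a d * (\<Sum>(i, j) | i * j = e. fds_nth b i * fds_nth c j))"
      by (rule sum_factor_pairs_assoc[OF n])
    also have "\<dots> = fds_nth (a * (b * c)) n"
      using n by (auto simp: times_fds_def fds_nth_fds intro!: sum.cong)
    finally show "fds_nth (a * b * c) n = fds_nth (a * (b * c)) n" .
  qed
  show "a * b = b * a"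
  proof (rule fds_eqI)
    fix n :: nat assume n: "n > 0"
    have "(\<Sum>(d, e) | d * e = n. fds_nth a d * fds_nth b e) =
          (\<Sum>(d, e) | d * e = n. fds_nth b d * fds_nth a e)"
      by (rule sum.reindex_bij_witness[where i = prod.swap and j = prod.swap])
         (auto simp: mult.commute)
    then show "fds_nth (a * b) n = fds_nth (b * a) n"
      by (simp add: times_fds_def fds_nth_fds)
  qed
  show "1 * a = a"
  proof (rule fds_eqI)
    fix n :: nat assume n: "n > 0"
    have "(\<Sum>(d, e) | d * e = n. fds_nth 1 d * fds_nth a e) =
          (\<Sum>(d, e) \<in> {(1, n)}. fds_nth 1 d * fds_nth a e)"
      using n finite_factor_pairs[OF n]
      by (intro sum.mono_neutral_right) (auto simp: one_fds_def fds_nth_fds split: if_splits)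
    then show "fds_nth (1 * a) n = fds_nth a n"
      using n by (simp add: times_fds_def one_fds_def fds_nth_fds)
  qed
  show "(a + b) * c = a * c + b * c"
    by (rule fds_eqI)
       (auto simp: times_fds_def plus_fds_def fds_nth_fds algebra_simps
          sum.distrib[symmetric] case_prod_beta intro!: sum.cong)
  have "fds_nth (0 :: 'a fds) 1 \<noteq> fds_nth 1 1"
    by (simp add: zero_fds_def one_fds_def fds_nth_fds)
  then show "(0 :: 'a fds) \<noteq> 1" by metis
qed (auto intro!: fds_eqI simp: fds_ring_defs fds_nth_fds algebra_simps)

end

text \<open>
  The series \<open>\<Sum>m\<ge>1. c m / p^(m s)\<close>. For \<open>p \<ge> 2\<close> the exponent \<open>m\<close> with \<open>n = p ^ m\<close> is unique.
\<close>

definition fds_powers :: "nat \<Rightarrow> (nat \<Rightarrow> 'a :: zero) \<Rightarrow> 'a fds" where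
  "fds_powers p c = fds (\<lambda>n. if \<exists>m\<ge>1. n = p ^ m then c (THE m. n = p ^ m) else 0)"

lemma fds_nth_powers:
  assumes "p \<ge> 2" "m \<ge> 1"
  shows "fds_nth (fds_powers p c) (p ^ m) = c m"
proof -
  have "(THE k. p ^ m = p ^ k) = m"
    using assms by (intro the_equality) auto
  then show ?thesis
    using assms by (auto simp: fds_powers_def fds_nth_fds)
qed

lemma fds_nth_powers_other:
  assumes "\<And>m. m \<ge> 1 \<Longrightarrow> n \<noteq> p ^ m"
  shows "fds_nth (fds_powers p c) n = 0"
  using assms by (auto simp: fds_powers_def fds_nth_fds)

text \<open>
  Convergence of an infinite product over the primes in the sense of coefficientwise eventual
  constancy of the finite products over \<open>p \<le> y\<close>.
\<close>

definition fds_has_prime_prod :: "(nat \<Rightarrow> 'a :: comm_ring_1 fds) \<Rightarrow> 'a fds \<Rightarrow> bool" where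
  "fds_has_prime_prod F A \<longleftrightarrow>
     (\<forall>n>0. eventually (\<lambda>y :: nat. fds_nth (\<Prod>p | prime p \<and> p \<le> y. F p) n = fds_nth A n) at_top)"

definition num_divisors :: "nat \<Rightarrow> nat" where
  "num_divisors n = card {d. d dvd n}"

definition num_prime_divisors :: "nat \<Rightarrow> nat" where
  "num_prime_divisors n = card {p. prime p \<and> p dvd n}"

end

theory Submission
  imports Defs
begin

text \<open>
  Both factors of \<open>d(N) x\<^sup>\<omega>\<^sup>(\<^sup>N\<^sup>)\<close> are multiplicative in \<open>N\<close>. For a multiplicative \<open>f\<close> and a finite set
  \<open>S\<close> of primes, the product of the Euler factors over \<open>S\<close> has coefficient \<open>f n\<close> at those \<open>n\<close> all of
  whose prime divisors lie in \<open>S\<close>, and \<open>0\<close> elsewhere: when a prime \<open>p\<close> is added to \<open>S\<close>, the only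
  factorisation of \<open>n\<close> contributing to the convolution splits off the full power of \<open>p\<close>.
\<close>

lemma fds_nth_Euler_factor_power:
  fixes f :: "nat \<Rightarrow> 'a :: comm_ring_1"
  assumes "p \<ge> 2" "f 1 = 1"
  shows "fds_nth (1 + fds_powers p (\<lambda>m. f (p ^ m))) (p ^ k) = f (p ^ k)"
proof (cases "k = 0")
  case True
  \<comment> \<open>\<open>fds_powers\<close> starts at exponent 1, so at index 1 only the summand
    \<open>1\<close> contributes; \<open>f 1 = 1\<close> makes this agree with
    \<open>f (p ^ 0)\<close>.\<close>
  have "fds_nth (fds_powers p (\<lambda>m. f (p ^ m))) 1 = 0"
    using assms by (intro fds_nth_powers_other) (auto dest: sym)
  then show ?thesis
    using True assms by (simp add: plus_fds_def one_fds_def fds_nth_fds)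
next
  case False
  then have "p ^ k \<noteq> 1"
    using assms by auto
  then show ?thesis
    using False assms by (simp add: plus_fds_def one_fds_def fds_nth_fds fds_nth_powers)
qed

lemma fds_nth_Euler_factor_other:
  fixes c :: "nat \<Rightarrow> 'a :: comm_ring_1"
  assumes "\<And>k. n \<noteq> p ^ k"
  shows "fds_nth (1 + fds_powers p c) n = 0"
  \<comment> \<open>Exponent 0 in the hypothesis says \<open>n \<noteq> 1\<close>, which removes the
    summand \<open>1\<close>.\<close>
  using assms[of 0] fds_nth_powers_other[of n p c] assms
  by (simp add: plus_fds_def one_fds_def fds_nth_fds)

lemma fds_nth_prod_Euler_factors:
  fixes f :: "nat \<Rightarrow> 'a :: comm_ring_1"
  assumes f_1: "f 1 = 1"
    and f_mult: "\<And>a b. a > 0 \<Longrightarrow> b > 0 \<Longrightarrow> coprime a b \<Longrightarrow> f (a * b) = f a * f b"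
    and "finite S" "\<And>p. p \<in> S \<Longrightarrow> prime p" "n > 0"
  shows "fds_nth (\<Prod>p\<in>S. 1 + fds_powers p (\<lambda>m. f (p ^ m))) n =
           (if prime_factors n \<subseteq> S then f n else 0)"
  using assms(3-5)
proof (induction S arbitrary: n rule: finite_induct)
  case empty
  have "prime_factors n \<subseteq> {} \<longleftrightarrow> n = 1"
    using empty.prems by (auto simp: prime_factorization_empty_iff)
  then show ?case
    using empty.prems f_1 by (simp add: one_fds_def fds_nth_fds)
next
  case (insert p S)
  have p: "prime p" and p2: "p \<ge> 2"
    using insert.prems prime_ge_2_nat by auto
  define B where "B = 1 + fds_powers p (\<lambda>m. f (p ^ m))"
  define A where "A = (\<Prod>p\<in>S. 1 + fds_powers p (\<lambda>m. f (p ^ m)))"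
  have A: "fds_nth A m = (if prime_factors m \<subseteq> S then f m else 0)" if "m > 0" for m
    unfolding A_def using that insert.prems by (intro insert.IH) auto
  obtain k r where n: "n = p ^ k * r" and r: "\<not> p dvd r"
    using multiplicity_decompose'[of n p] p insert.prems by (metis not_prime_unit not_gr0)
  have r0: "r > 0"
    using r by (auto intro: Nat.gr0I)
  \<comment> \<open>\<open>B\<close> vanishes unless \<open>d\<close> is a power of
    \<open>p\<close>, and \<open>A\<close> vanishes when \<open>p dvd e\<close> because
    \<open>p \<notin> S\<close>. In the remaining case, comparing multiplicities of \<open>p\<close>
    forces \<open>d = p ^ k\<close>, and cancelling gives \<open>e = r\<close>, the excluded
    pair.\<close>
  have "fds_nth B d * fds_nth A e = 0" if "d * e = n" "(d, e) \<noteq> (p ^ k, r)" for d e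
  proof (cases "(\<exists>j. d = p ^ j) \<and> \<not> p dvd e")
    case True
    then obtain j where d: "d = p ^ j" by blast
    have "j = k"
    proof -
      have "multiplicity p (p ^ j * e) = j" "multiplicity p (p ^ k * r) = k"
        using p True r p2 by (auto intro!: multiplicity_eqI simp: mult.commute)
      then show ?thesis using that d n by simp
    qed
    with that d n p2 show ?thesis by auto
  next
    case False
    have "e > 0"
      using that insert.prems by (auto intro: Nat.gr0I)
    show ?thesis
    proof (cases "p dvd e")
      case True
      then have "p \<in> prime_factors e"
        using p \<open>e > 0\<close> by (simp add: prime_factors_dvd)
      then have "fds_nth A e = 0"
        using A[OF \<open>e > 0\<close>] insert.hyps by auto
      then show ?thesis by simp
    next
      assume "\<not> p dvd e"
      then have "fds_nth B d = 0"
        unfolding B_def using False by (intro fds_nth_Euler_factor_other) auto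
      then show ?thesis by simp
    qed
  qed
  then have "(\<Sum>(d, e) | d * e = n. fds_nth B d * fds_nth A e) =
             (\<Sum>(d, e) \<in> {(p ^ k, r)}. fds_nth B d * fds_nth A e)"
    using insert.prems n by (intro sum.mono_neutral_right finite_factor_pairs) auto
  then have "fds_nth (B * A) n = fds_nth B (p ^ k) * fds_nth A r"
    using insert.prems by (simp add: times_fds_def fds_nth_fds)
  also have "\<dots> = f (p ^ k) * (if prime_factors r \<subseteq> S then f r else 0)"
    unfolding B_def using p2 f_1 A[OF r0] by (simp only: fds_nth_Euler_factor_power)
  \<comment> \<open>Passing from \<open>r\<close> to \<open>n\<close> can add only the prime
    \<open>p\<close>, which \<open>insert p S\<close> admits; as \<open>p\<close> does not divide
    \<open>r\<close>, allowing \<open>p\<close> does not weaken the condition on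
    \<open>r\<close>.\<close>
  also have "prime_factors r \<subseteq> S \<longleftrightarrow> prime_factors n \<subseteq> insert p S"
  proof -
    have "prime_factors n = (if k = 0 then {} else {p}) \<union> prime_factors r"
      using p r0 p2
      by (auto simp: n prime_factors_dvd prime_dvd_mult_iff prime_dvd_power_iff primes_dvd_imp_eq
            dest: prime_dvd_power)
    moreover have "p \<notin> prime_factors r"
      using r by (auto simp: prime_factors_dvd)
    ultimately show ?thesis by auto
  qed
  also have "f (p ^ k) * (if prime_factors n \<subseteq> insert p S then f r else 0) =
             (if prime_factors n \<subseteq> insert p S then f n else 0)"
  proof -
    have "coprime (p ^ k) r"
      using p r by (simp add: prime_imp_coprime coprime_power_left_iff)
    then show ?thesis
      using f_mult[of "p ^ k" r] r0 p2 by (simp add: n)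
  qed
  finally show ?case
    using insert.hyps by (simp add: A_def B_def)
qed

text \<open>Every prime factor of \<open>n\<close> is at most \<open>n\<close>, so the coefficient
  at \<open>n\<close> of the finite product equals \<open>f n\<close> from \<open>y = n\<close>
  on.\<close>

lemma fds_has_prime_prod_multiplicative:
  fixes f :: "nat \<Rightarrow> 'a :: comm_ring_1"
  assumes "f 1 = 1"
    and "\<And>a b. a > 0 \<Longrightarrow> b > 0 \<Longrightarrow> coprime a b \<Longrightarrow> f (a * b) = f a * f b"
  shows "fds_has_prime_prod (\<lambda>p. 1 + fds_powers p (\<lambda>m. f (p ^ m))) (fds f)"
  unfolding fds_has_prime_prod_def
proof (intro allI impI)
  fix n :: nat assume n: "n > 0"
  show "\<forall>\<^sub>F y in at_top. fds_nth (\<Prod>p | prime p \<and> p \<le> y. 1 + fds_powers p (\<lambda>m. f (p ^ m))) n =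
          fds_nth (fds f) n"
    using eventually_ge_at_top[of n]
  proof eventually_elim
    case (elim y)
    have "prime_factors n \<subseteq> {p. prime p \<and> p \<le> y}"
      using n elim by (auto simp: prime_factors_dvd dest!: dvd_imp_le)
    moreover have "fds_nth (\<Prod>p | prime p \<and> p \<le> y. 1 + fds_powers p (\<lambda>m. f (p ^ m))) n =
                     (if prime_factors n \<subseteq> {p. prime p \<and> p \<le> y} then f n else 0)"
      using assms n by (intro fds_nth_prod_Euler_factors) auto
    ultimately show ?case
      using n by (simp add: fds_nth_fds)
  qed
qed

text \<open>For coprime \<open>a\<close> and \<open>b\<close>, multiplication is a bijection from
  pairs of a divisor of \<open>a\<close> and a divisor of \<open>b\<close> onto the divisors of
  \<open>a * b\<close>.\<close>

lemma num_divisors_mult: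
  assumes "coprime a b"
  shows "num_divisors (a * b) = num_divisors a * num_divisors b"
proof -
  have "bij_betw (\<lambda>(c, d). c * d) ({c. c dvd a} \<times> {d. d dvd b}) {e. e dvd a * b}"
    unfolding bij_betw_def
  proof
    show "inj_on (\<lambda>(c, d). c * d) ({c. c dvd a} \<times> {d. d dvd b})"
    proof (clarsimp simp: inj_on_def)
      fix c d c' d'
      assume *: "c dvd a" "d dvd b" "c' dvd a" "d' dvd b" "c * d = c' * d'"
      have "coprime c d'" "coprime c' d"
        using * assms by (auto intro: coprime_divisors)
      \<comment> \<open>By coprimality \<open>c\<close> and \<open>c'\<close> divide each other, and
        likewise \<open>d\<close> and \<open>d'\<close>.\<close>
      with *(5) show "c = c' \<and> d = d'"
        by (simp add: coprime_crossproduct_nat mult.commute)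
    qed
    show "(\<lambda>(c, d). c * d) ` ({c. c dvd a} \<times> {d. d dvd b}) = {e. e dvd a * b}"
      by (auto intro: mult_dvd_mono elim!: dvd_productE simp: image_iff)
  qed
  from bij_betw_same_card[OF this] show ?thesis
    by (simp add: num_divisors_def card_cartesian_product)
qed

lemma num_divisors_prime_power:
  assumes "prime p"
  shows "num_divisors (p ^ m) = m + 1"
proof -
  have "{d. d dvd p ^ m} = (\<lambda>k. p ^ k) ` {..m}"
    using assms by (auto simp: divides_primepow_nat)
  moreover have "inj_on (\<lambda>k. p ^ k) {..m}"
    using prime_gt_1_nat[OF assms] by (auto simp: inj_on_def)
  ultimately show ?thesis
    by (simp add: num_divisors_def card_image)
qed

text \<open>Coprimality makes the two sets of prime divisors disjoint, and positivity makes them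
  finite, so their cardinalities add.\<close>

lemma num_prime_divisors_mult:
  assumes "a > 0" "b > 0" "coprime a b"
  shows "num_prime_divisors (a * b) = num_prime_divisors a + num_prime_divisors b"
proof -
  have "{p. prime p \<and> p dvd a * b} = {p. prime p \<and> p dvd a} \<union> {p. prime p \<and> p dvd b}"
    by (auto simp: prime_dvd_mult_iff)
  moreover have "{p. prime p \<and> p dvd a} \<inter> {p. prime p \<and> p dvd b} = {}"
    using assms(3) by (auto dest: coprime_common_divisor_nat)
  ultimately show ?thesis
    using assms by (simp add: num_prime_divisors_def card_Un_disjoint)
qed

lemma num_prime_divisors_prime_power:
  assumes "prime p" "m > 0"
  shows "num_prime_divisors (p ^ m) = 1"
proof -
  have "{q. prime q \<and> q dvd p ^ m} = {p}"
    using assms by (auto simp: prime_dvd_power_iff primes_dvd_imp_eq dest: prime_dvd_power)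
  then show ?thesis by (simp add: num_prime_divisors_def)
qed

text \<open>Allows the Euler factors to be rewritten by formulas that are valid only at
  primes.\<close>

lemma fds_has_prime_prod_cong:
  assumes "\<And>p. prime p \<Longrightarrow> F p = G p"
  shows "fds_has_prime_prod F A \<longleftrightarrow> fds_has_prime_prod G A"
proof -
  have "(\<Prod>p | prime p \<and> p \<le> y. F p) = (\<Prod>p | prime p \<and> p \<le> y. G p)" for y
    using assms by (intro prod.cong) auto
  then show ?thesis by (simp add: fds_has_prime_prod_def)
qed

text \<open>The coefficient function is read only at exponents from 1 on. This matters below, where
  the two functions differ at exponent 0: one gives \<open>1\<close>, the other
  \<open>x\<close>.\<close>

lemma fds_powers_cong:
  assumes "p \<ge> 2" "\<And>m. m \<ge> 1 \<Longrightarrow> c m = c' m"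
  shows "fds_powers p c = fds_powers p c'"
proof (rule fds_eqI)
  fix n :: nat
  show "fds_nth (fds_powers p c) n = fds_nth (fds_powers p c') n"
  proof (cases "\<exists>m\<ge>1. n = p ^ m")
    case True
    then show ?thesis using assms by (auto simp: fds_nth_powers)
  next
    case False
    then show ?thesis by (subst (1 2) fds_nth_powers_other) auto
  qed
qed

theorem lemmaC:
  shows "let x = [:0, 1:] :: int poly in
         fds_has_prime_prod
           (\<lambda>p. 1 + fds_powers p (\<lambda>m. of_nat (1 + m) * x))
           (1 + fds (\<lambda>N. if N \<ge> 2 then of_nat (num_divisors N) * x ^ num_prime_divisors N else 0))"
proof -
  define x where "x = ([:0, 1:] :: int poly)"
  define f where "f N = of_nat (num_divisors N) * x ^ num_prime_divisors N" for N
  have f_1: "f 1 = 1"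
  proof -
    have "{p :: nat. prime p \<and> p dvd 1} = {}" by auto
    then have "num_prime_divisors 1 = 0"
      unfolding num_prime_divisors_def by (simp only: card.empty)
    then show ?thesis
      by (simp add: f_def num_divisors_def)
  qed
  have "fds_has_prime_prod (\<lambda>p. 1 + fds_powers p (\<lambda>m. f (p ^ m))) (fds f)"
    using f_1
    by (rule fds_has_prime_prod_multiplicative)
       (simp add: f_def num_divisors_mult num_prime_divisors_mult power_add mult_ac)
  \<comment> \<open>The cutoff \<open>N \<ge> 2\<close> drops index 1, whose coefficient
    \<open>f 1 = 1\<close> becomes the summand \<open>1\<close>.\<close>
  also have "fds f = 1 + fds (\<lambda>N. if N \<ge> 2 then f N else 0)"
  proof (rule fds_eqI)
    fix n :: nat assume "n > 0"
    then consider "n = 1" | "n \<ge> 2" by linarith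
    then show "fds_nth (fds f) n = fds_nth (1 + fds (\<lambda>N. if N \<ge> 2 then f N else 0)) n"
      by cases (use f_1 in \<open>auto simp: plus_fds_def one_fds_def fds_nth_fds\<close>)
  qed
  \<comment> \<open>A prime power with \<open>m \<ge> 1\<close> has \<open>m + 1\<close> divisors
    and one prime divisor, so \<open>x\<close> occurs to the first power.\<close>
  also have "fds_has_prime_prod (\<lambda>p. 1 + fds_powers p (\<lambda>m. f (p ^ m))) \<dots> \<longleftrightarrow>
             fds_has_prime_prod (\<lambda>p. 1 + fds_powers p (\<lambda>m. of_nat (1 + m) * x)) \<dots>"
  proof (intro fds_has_prime_prod_cong arg_cong2[where f = "(+)"] refl fds_powers_cong)
    fix p m :: nat
    assume "prime p" "m \<ge> 1"
    then show "f (p ^ m) = of_nat (1 + m) * x"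
      by (simp add: f_def num_divisors_prime_power num_prime_divisors_prime_power)
  qed (rule prime_ge_2_nat)
  finally show ?thesis
    unfolding Let_def f_def x_def .
qed

end
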